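(* Let $s\in\mathbb N$, $s\geq 1$, and let $\mathcal N=\{\mathcal N_0,\ldots,\mathcal N_s\}$ be a complement up to degree $s$ of a proper homogeneous ideal $J$ in $\mathcal P=\mathbb K[x_0,\ldots,x_n]$. Let $\mathcal V_1,\ldots,\mathcal V_s$ be given, where $\mathcal V_k$ is a basis of the vector space $J\cap\langle\mathcal N_{k-1}^+\rangle$ for each $k=1,\ldots,s$. Then for each $k=1,\ldots,s$ it is possible to construct a set of polynomials $\mathcal G_k\subseteq\mathcal V_k$ such that $\mathcal G_1\cup\ldots\cup\mathcal G_s$ is a minimal set of generators of the ideal $I(J_1,\ldots,J_s)$.
   Context: $\mathbb K$ is an algebraically closed field; $\mathcal P=\mathbb K[x_0,\ldots,x_n]$; $\mathcal T_k$ is the set of monomials of degree $k$ and $\mathcal P_k$ is its $\mathbb K$-span; for a homogeneous ideal $J$, $J_k=J\cap\mathcal P_k$. For $S\subset\mathcal P_k$, $\langle S\rangle$ denotes the $\mathbb K$-span of $S$ and $S^+=\bigcup_{j=0}^n x_jS\subset\mathcal P_{k+1}$. $I(J_1,\ldots,J_s)$ is the ideal of $\mathcal P$ generated by $J_1\cup\ldots\cup J_s$. Complement: for a proper homogeneous ideal $J$, a family $\mathcal N=\{\mathcal N_0,\ldots,\mathcal N_s\}$ is a complement of $J$ up to degree $s$ if $\mathcal N_0=\{1\}$ and, for each $k=1,\ldots,s$, $\mathcal N_k\subseteq\mathcal T_k$ is a set of monomials with $\mathcal N_k\subset\mathcal N_{k-1}^+$ and $\mathcal P_k=J_k\oplus\langle\mathcal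 N_k\rangle$. A set of generators of an ideal is minimal if no proper subset of it generates the ideal. *)

theory Defs
  imports "HOL-Library.Poly_Mapping" "HOL-Computational_Algebra.Polynomial"
begin

text \<open>
  The ring $K[x_0,\dots,x_n]$ is the type of finitely supported functions from exponent vectors to
  coefficients, with the convolution product of \<^theory>\<open>HOL-Library.Poly_Mapping\<close>. The variables are
  indexed by a finite type of \<open>n + 1\<close> elements. Types are nonempty, so every \<open>n \<ge> 0\<close> is covered.
\<close>

type_synonym ('v, 'k) mpoly = "('v \<Rightarrow>\<^sub>0 nat) \<Rightarrow>\<^sub>0 'k"

definition Var :: "'v \<Rightarrow> ('v, 'k::comm_ring_1) mpoly" where
  "Var j = Poly_Mapping.single (Poly_Mapping.single j 1) 1"

definition mscale :: "'k::comm_ring_1 \<Rightarrow> ('v, 'k) mpoly \<Rightarrow> ('v, 'k) mpoly" where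
  "mscale c p = Poly_Mapping.single 0 c * p"

lemma lookup_mscale:
  fixes p :: "('v, 'k::comm_ring_1) mpoly"
  shows "Poly_Mapping.lookup (mscale c p) m = c * Poly_Mapping.lookup p m"
proof -
  have "mscale c p = Poly_Mapping.map ((*) c) p"
    unfolding mscale_def by (rule mult_map_scale_conv_mult [symmetric])
  then show ?thesis
    by (simp add: Poly_Mapping.map.rep_eq when_def)
qed

global_interpretation mpoly_vs:
  vector_space "mscale :: 'k::field \<Rightarrow> ('v, 'k) mpoly \<Rightarrow> ('v, 'k) mpoly"
  by unfold_locales
    (simp_all add: mscale_def distrib_left distrib_right single_add mult_single mult.assoc [symmetric])

text \<open>An ideal is a submodule of the ring over itself; the span is the ideal generated by a set.\<close>

global_interpretation mpoly_ideal:
  module "(*) :: ('v, 'k::comm_ring_1) mpoly \<Rightarrow> ('v, 'k) mpoly \<Rightarrow> ('v, 'k) mpoly"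
  by unfold_locales (simp_all add: algebra_simps)

abbreviation is_ideal :: "('v, 'k::comm_ring_1) mpoly set \<Rightarrow> bool" where
  "is_ideal \<equiv> mpoly_ideal.subspace"

abbreviation ideal_gen :: "('v, 'k::comm_ring_1) mpoly set \<Rightarrow> ('v, 'k) mpoly set" where
  "ideal_gen \<equiv> mpoly_ideal.span"

definition monomials_of_degree :: "nat \<Rightarrow> ('v::finite, 'k::field) mpoly set" where
  "monomials_of_degree k =
     {Poly_Mapping.single m 1 | m. (\<Sum>j\<in>UNIV. Poly_Mapping.lookup m j) = k}"

definition forms_of_degree :: "nat \<Rightarrow> ('v::finite, 'k::field) mpoly set" where
  "forms_of_degree k = mpoly_vs.span (monomials_of_degree k)"

definition homogeneous :: "('v::finite, 'k::field) mpoly \<Rightarrow> bool" where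
  "homogeneous p \<longleftrightarrow> (\<exists>k. p \<in> forms_of_degree k)"

definition homogeneous_ideal :: "('v::finite, 'k::field) mpoly set \<Rightarrow> bool" where
  "homogeneous_ideal J \<longleftrightarrow>
     is_ideal J \<and> (\<exists>F. (\<forall>f\<in>F. homogeneous f) \<and> J = ideal_gen F)"

definition proper_ideal :: "('v, 'k::field) mpoly set \<Rightarrow> bool" where
  "proper_ideal J \<longleftrightarrow> is_ideal J \<and> J \<noteq> UNIV"

definition graded_part :: "('v::finite, 'k::field) mpoly set \<Rightarrow> nat \<Rightarrow> ('v, 'k) mpoly set" where
  "graded_part J k = J \<inter> forms_of_degree k"

definition shift_up :: "('v::finite, 'k::field) mpoly set \<Rightarrow> ('v, 'k) mpoly set" where
  "shift_up S = (\<Union>j. (\<lambda>p. Var j * p) ` S)"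

definition direct_sum_of ::
  "('v, 'k::field) mpoly set \<Rightarrow> ('v, 'k) mpoly set \<Rightarrow> ('v, 'k) mpoly set \<Rightarrow> bool" where
  "direct_sum_of V U W \<longleftrightarrow>
     mpoly_vs.subspace U \<and> mpoly_vs.subspace W \<and>
     V = {u + w | u w. u \<in> U \<and> w \<in> W} \<and> U \<inter> W = {0}"

text \<open>A family up to degree \<open>s\<close> is a function of the degree whose values beyond \<open>s\<close> are ignored.\<close>

definition complement_upto ::
  "nat \<Rightarrow> ('v::finite, 'k::field) mpoly set \<Rightarrow> (nat \<Rightarrow> ('v, 'k) mpoly set) \<Rightarrow> bool" where
  "complement_upto s J N \<longleftrightarrow>
     N 0 = {1} \<and>
     (\<forall>k\<in>{1..s}. N k \<subseteq> monomials_of_degree k \<and> N k \<subseteq> shift_up (N (k - 1)) \<and>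
        direct_sum_of (forms_of_degree k) (graded_part J k) (mpoly_vs.span (N k)))"

definition is_basis_of :: "('v, 'k::field) mpoly set \<Rightarrow> ('v, 'k) mpoly set \<Rightarrow> bool" where
  "is_basis_of B U \<longleftrightarrow> \<not> mpoly_vs.dependent B \<and> mpoly_vs.span B = U"

definition minimal_generators :: "('v, 'k::field) mpoly set \<Rightarrow> ('v, 'k) mpoly set \<Rightarrow> bool" where
  "minimal_generators G I \<longleftrightarrow> ideal_gen G = I \<and> (\<forall>H. H \<subset> G \<longrightarrow> ideal_gen H \<noteq> I)"

end

theory Submission
  imports Defs
begin

text \<open>
  The union of all the bases \<open>V k\<close> generates the ideal, and it is finite, so it contains an
  inclusion-minimal generating subset, whose intersections with the \<open>V k\<close> are the required sets.

  That the bases generate is an induction on the degree. Write a form \<open>f\<close> of \<open>J\<close> of degree \<open>k + 1\<close>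
  as a sum of products of a variable with a form of degree \<open>k\<close>, and split each of these forms along
  \<open>J\<^sub>k \<oplus> \<langle>N k\<rangle>\<close>. The products with the \<open>J\<close>-components lie in the ideal generated
  by \<open>J\<^sub>k\<close>, which the induction hypothesis covers. The remaining products add up to an
  element of \<open>\<langle>N k\<^sup>+\<rangle>\<close> that differs from \<open>f\<close> by an element of \<open>J\<close>, so it lies in
  \<open>J \<inter> \<langle>N k\<^sup>+\<rangle>\<close> and is a combination of \<open>V (k + 1)\<close>. This is
  \<open>graded_part_subset_ideal_gen\<close>.

  Finiteness comes from linear algebra: \<open>N k\<close> is finite because it lies in the \<open>k\<close>-fold shift of
  \<open>N 0 = {1}\<close> by finitely many variables, and \<open>V k\<close> is independent in the span of a finite set.
\<close>

section \<open>Ideals, spans and shifts\<close>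

lemma is_ideal_imp_subspace:
  assumes "is_ideal I"
  shows "mpoly_vs.subspace I"
  using assms unfolding mpoly_ideal.subspace_def mpoly_vs.subspace_def mscale_def by blast

lemma span_subset_ideal_gen: "mpoly_vs.span S \<subseteq> ideal_gen S"
  by (intro mpoly_vs.span_minimal mpoly_ideal.span_superset
      is_ideal_imp_subspace mpoly_ideal.subspace_span)

lemma mscale_mult_right: "p * mscale c q = mscale c (p * q)"
  unfolding mscale_def by (rule mult.left_commute)

lemma finite_shift_up:
  assumes "finite S"
  shows "finite (shift_up S)"
  using assms unfolding shift_up_def by simp

lemma Var_mult_in_span_shift_up:
  assumes "p \<in> mpoly_vs.span S"
  shows "Var j * p \<in> mpoly_vs.span (shift_up S)"
  using assms
proof (induction rule: mpoly_vs.span_induct_alt)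
  case base
  show ?case by (simp add: mpoly_vs.span_zero)
next
  case (step c x y)
  have "Var j * x \<in> shift_up S"
    using step(1) unfolding shift_up_def by blast
  then have "mscale c (Var j * x) + Var j * y \<in> mpoly_vs.span (shift_up S)"
    by (intro mpoly_vs.span_add mpoly_vs.span_scale mpoly_vs.span_base step)
  then show ?case
    by (simp add: distrib_left mscale_mult_right)
qed

section \<open>Monomials by degree\<close>

lemma Var_mult_single:
  "Var j * Poly_Mapping.single m 1 = Poly_Mapping.single (Poly_Mapping.single j 1 + m) 1"
  by (simp add: Var_def mult_single)

lemma sum_lookup_single_add:
  fixes m :: "'v::finite \<Rightarrow>\<^sub>0 nat"
  shows "(\<Sum>i\<in>UNIV. Poly_Mapping.lookup (Poly_Mapping.single j 1 + m) i)
    = Suc (\<Sum>i\<in>UNIV. Poly_Mapping.lookup m i)"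
  by (simp add: lookup_add lookup_single sum.distrib when_def)

lemma monomials_of_degree_0: "(monomials_of_degree 0 :: ('v::finite, 'k::field) mpoly set) = {1}"
proof -
  have "(\<Sum>j\<in>UNIV. Poly_Mapping.lookup m j) = 0 \<longleftrightarrow> m = 0" for m :: "'v \<Rightarrow>\<^sub>0 nat"
    by (auto intro: poly_mapping_eqI)
  \<comment> \<open>The default rule would rewrite the degree condition before this equivalence applies.\<close>
  then show ?thesis
    unfolding monomials_of_degree_def by (simp del: sum_eq_0_iff)
qed

lemma monomials_of_degree_Suc:
  "monomials_of_degree (Suc k) = shift_up (monomials_of_degree k)"
proof (intro equalityI subsetI)
  fix p :: "('v::finite, 'k::field) mpoly"
  assume "p \<in> monomials_of_degree (Suc k)"
  then obtain m where p: "p = Poly_Mapping.single m 1"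
    and deg: "(\<Sum>i\<in>UNIV. Poly_Mapping.lookup m i) = Suc k"
    unfolding monomials_of_degree_def by blast
  from deg obtain j where j: "Poly_Mapping.lookup m j \<noteq> 0"
    by (metis nat.distinct(1) sum.neutral)
  define m' where "m' = m - Poly_Mapping.single j 1"
  have m: "m = Poly_Mapping.single j 1 + m'"
    using j by (intro poly_mapping_eqI)
      (auto simp: m'_def lookup_add lookup_minus lookup_single when_def)
  have "(\<Sum>i\<in>UNIV. Poly_Mapping.lookup m' i) = k"
    using deg sum_lookup_single_add[of j m'] m by simp
  then have "Poly_Mapping.single m' 1 \<in> monomials_of_degree k"
    unfolding monomials_of_degree_def by blast
  moreover have "p = Var j * Poly_Mapping.single m' 1"
    by (simp only: p m Var_mult_single)
  ultimately show "p \<in> shift_up (monomials_of_degree k)"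
    unfolding shift_up_def by blast
next
  fix p :: "('v::finite, 'k::field) mpoly"
  assume "p \<in> shift_up (monomials_of_degree k)"
  then obtain j m where p: "p = Poly_Mapping.single (Poly_Mapping.single j 1 + m) 1"
    and deg: "(\<Sum>i\<in>UNIV. Poly_Mapping.lookup m i) = k"
    unfolding shift_up_def monomials_of_degree_def by (auto simp: Var_mult_single)
  then show "p \<in> monomials_of_degree (Suc k)"
    unfolding monomials_of_degree_def using sum_lookup_single_add[of j m] by auto
qed

section \<open>Complements of an ideal\<close>

lemma complement_upto_subset_monomials:
  assumes "complement_upto s J N" "k \<le> s"
  shows "N k \<subseteq> monomials_of_degree k"
  using assms unfolding complement_upto_def
  by (cases "k = 0") (auto simp: monomials_of_degree_0)

lemma complement_upto_finite:
  assumes "complement_upto s J N" "k \<le> s"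
  shows "finite (N k)"
  using assms(2)
proof (induction k)
  case 0
  show ?case using assms(1) unfolding complement_upto_def by simp
next
  case (Suc k)
  then have "N (Suc k) \<subseteq> shift_up (N k)"
    using assms(1) unfolding complement_upto_def by force
  then show ?case
    using Suc finite_shift_up finite_subset by (metis Suc_leD)
qed

lemma span_shift_up_complement_subset_forms:
  assumes "complement_upto s J N" "k \<le> s"
  shows "mpoly_vs.span (shift_up (N k)) \<subseteq> forms_of_degree (Suc k)"
  unfolding forms_of_degree_def monomials_of_degree_Suc
  using complement_upto_subset_monomials[OF assms]
  by (intro mpoly_vs.span_mono) (auto simp: shift_up_def)

text \<open>
  In degree \<open>0\<close> the summand from \<open>J\<close> can be taken to be \<open>0\<close>, since \<open>N 0 = {1}\<close> already spans the
  constants.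
\<close>

lemma complement_upto_decompose:
  assumes "complement_upto s J N" "is_ideal J" "k \<le> s" "p \<in> forms_of_degree k"
  obtains u w where "u \<in> graded_part J k" "w \<in> mpoly_vs.span (N k)" "p = u + w"
proof (cases "k = 0")
  case True
  have "0 \<in> graded_part J k"
    unfolding graded_part_def forms_of_degree_def
    using mpoly_ideal.subspace_0[OF assms(2)] mpoly_vs.span_zero by blast
  moreover have "p \<in> mpoly_vs.span (N k)"
    using assms(1,4) True
    by (simp add: complement_upto_def forms_of_degree_def monomials_of_degree_0)
  ultimately show thesis using that[of 0 p] by simp
next
  case False
  then have "direct_sum_of (forms_of_degree k) (graded_part J k) (mpoly_vs.span (N k))"
    using assms(1,3) unfolding complement_upto_def by auto
  then show thesis
    using assms(4) that unfolding direct_sum_of_def by blast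
qed

text \<open>
  Shifting the decomposition of degree \<open>k\<close> by the variables decomposes degree \<open>k + 1\<close> modulo any
  ideal \<open>I\<close> that contains the part of \<open>J\<close> in degree \<open>k\<close>. It is enough to see this for a
  monomial, which is a variable times a monomial of degree \<open>k\<close>, because the sums on the right
  form a linear subspace.
\<close>

lemma forms_of_degree_Suc_decompose:
  fixes J :: "('v::finite, 'k::field) mpoly set"
  assumes compl: "complement_upto s J N" and J: "is_ideal J" and "k \<le> s"
    and I: "is_ideal I" and JI: "graded_part J k \<subseteq> I"
  shows "forms_of_degree (Suc k) \<subseteq> {a + b | a b. a \<in> I \<and> b \<in> mpoly_vs.span (shift_up (N k))}"
    (is "_ \<subseteq> ?S")
  unfolding forms_of_degree_def
proof (rule mpoly_vs.span_minimal)
  show "monomials_of_degree (Suc k) \<subseteq> ?S"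
  proof
    fix p :: "('v, 'k) mpoly"
    assume "p \<in> monomials_of_degree (Suc k)"
    then obtain j q where p: "p = Var j * q" and q: "q \<in> monomials_of_degree k"
      unfolding monomials_of_degree_Suc shift_up_def by blast
    from q have "q \<in> forms_of_degree k"
      unfolding forms_of_degree_def by (rule mpoly_vs.span_base)
    then obtain u w where u: "u \<in> graded_part J k" and w: "w \<in> mpoly_vs.span (N k)"
      and "q = u + w"
      using complement_upto_decompose[OF compl J \<open>k \<le> s\<close>] by blast
    then have "p = Var j * u + Var j * w"
      by (simp add: p distrib_left)
    moreover have "Var j * u \<in> I"
      using u JI mpoly_ideal.subspace_scale[OF I] by blast
    ultimately show "p \<in> ?S"
      using Var_mult_in_span_shift_up[OF w] by blast
  qed
  show "mpoly_vs.subspace ?S"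
    using mpoly_vs.subspace_sums[OF is_ideal_imp_subspace[OF I] mpoly_vs.subspace_span] .
qed

section \<open>Generators from the bases\<close>

lemma proper_ideal_graded_part_0:
  assumes "proper_ideal J"
  shows "graded_part J 0 = {0}"
proof -
  have J: "is_ideal J" and "J \<noteq> UNIV"
    using assms unfolding proper_ideal_def by auto
  have "1 \<notin> J"
  proof
    assume "1 \<in> J"
    then have "p \<in> J" for p
      using mpoly_ideal.subspace_scale[OF J, of 1 p] by simp
    with \<open>J \<noteq> UNIV\<close> show False by blast
  qed
  moreover have "1 \<in> J" if "mscale c 1 \<in> J" "c \<noteq> 0" for c
    using mpoly_vs.subspace_scale[OF is_ideal_imp_subspace[OF J] that(1), of "inverse c"] that(2)
    by simp
  ultimately have "mscale c 1 = 0" if "mscale c 1 \<in> J" for c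
    using that by (cases "c = 0") auto
  then have "graded_part J 0 \<subseteq> {0}"
    unfolding graded_part_def forms_of_degree_def monomials_of_degree_0
    by (auto simp: mpoly_vs.span_singleton)
  moreover have "0 \<in> graded_part J 0"
    unfolding graded_part_def forms_of_degree_def
    using mpoly_ideal.subspace_0[OF J] mpoly_vs.span_zero by blast
  ultimately show ?thesis by blast
qed

text \<open>
  The induction starts in degree \<open>0\<close>, where a proper ideal has only the zero form. The step
  from degree \<open>k\<close> to \<open>k + 1\<close> subtracts from a form \<open>f\<close> of \<open>J\<close> a part \<open>a\<close> in the ideal generated by the bases.
  This ideal is contained in \<open>J\<close>, so the remainder stays in \<open>J\<close>.
\<close>

lemma graded_part_subset_ideal_gen:
  assumes compl: "complement_upto s J N" and "proper_ideal J"
    and V: "\<And>k. k \<in> {1..s} \<Longrightarrow>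
      mpoly_vs.span (V k) = J \<inter> mpoly_vs.span (shift_up (N (k - 1)))"
    and "k \<le> s"
  shows "graded_part J k \<subseteq> ideal_gen (\<Union>i\<in>{1..s}. V i)"
  using \<open>k \<le> s\<close>
proof (induction k)
  case 0
  show ?case
    by (simp add: proper_ideal_graded_part_0 \<open>proper_ideal J\<close> mpoly_ideal.span_zero)
next
  case (Suc k)
  let ?I = "ideal_gen (\<Union>i\<in>{1..s}. V i)"
  have k: "k \<le> s" using Suc.prems by simp
  have J: "is_ideal J"
    using \<open>proper_ideal J\<close> unfolding proper_ideal_def by blast
  have "V i \<subseteq> J" if "i \<in> {1..s}" for i
    using V[OF that] mpoly_vs.span_superset[of "V i"] by blast
  then have IJ: "?I \<subseteq> J"
    by (intro mpoly_ideal.span_minimal J) blast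
  have "mpoly_vs.span (V (Suc k)) \<subseteq> ideal_gen (V (Suc k))"
    by (rule span_subset_ideal_gen)
  also have "\<dots> \<subseteq> ?I"
    using Suc.prems by (intro mpoly_ideal.span_mono) force
  finally have VI: "mpoly_vs.span (V (Suc k)) \<subseteq> ?I" .
  show ?case
  proof
    fix f assume f: "f \<in> graded_part J (Suc k)"
    then have "f \<in> forms_of_degree (Suc k)"
      unfolding graded_part_def by blast
    with forms_of_degree_Suc_decompose[OF compl J k mpoly_ideal.subspace_span Suc.IH[OF k]]
    obtain a b where a: "a \<in> ?I" and b: "b \<in> mpoly_vs.span (shift_up (N k))"
      and "f = a + b"
      by blast
    then have "b = f - a" by simp
    with f a IJ have "b \<in> J"
      using mpoly_ideal.subspace_diff[OF J] unfolding graded_part_def by blast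
    with b have "b \<in> ?I"
      using V[of "Suc k"] VI Suc.prems by auto
    with a show "f \<in> ?I"
      unfolding \<open>f = a + b\<close> by (rule mpoly_ideal.span_add)
  qed
qed

text \<open>
  Among the finitely many subsets of \<open>B\<close> that still generate, take an inclusion-minimal one: a
  proper subset of it is again a subset of \<open>B\<close>, so it cannot generate.
\<close>

lemma finite_generators_contain_minimal:
  assumes "finite B" "ideal_gen B = I"
  obtains G where "G \<subseteq> B" "minimal_generators G I"
proof -
  let ?A = "{H. H \<subseteq> B \<and> ideal_gen H = I}"
  have "finite ?A" "?A \<noteq> {}"
    using assms by auto
  then obtain G where "G \<in> ?A" "\<forall>H\<in>?A. H \<le> G \<longrightarrow> G = H"
    using finite_has_minimal[of ?A] by blast
  then have "G \<subseteq> B" "minimal_generators G I"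
    unfolding minimal_generators_def by blast+
  then show thesis by (rule that)
qed

theorem proposition2p13:
  fixes J :: "('v::finite, 'k::alg_closed_field) mpoly set"
    and N V :: "nat \<Rightarrow> ('v, 'k) mpoly set"
    and s :: nat
  assumes "s \<ge> 1"
    and "homogeneous_ideal J"
    and "proper_ideal J"
    and "complement_upto s J N"
    and "\<forall>k\<in>{1..s}. is_basis_of (V k) (J \<inter> mpoly_vs.span (shift_up (N (k - 1))))"
  shows "\<exists>G. (\<forall>k\<in>{1..s}. G k \<subseteq> V k) \<and>
    minimal_generators (\<Union>k\<in>{1..s}. G k) (ideal_gen (\<Union>k\<in>{1..s}. graded_part J k))"
proof -
  let ?V = "\<Union>k\<in>{1..s}. V k"
  let ?I = "ideal_gen (\<Union>k\<in>{1..s}. graded_part J k)"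
  have indep: "\<not> mpoly_vs.dependent (V k)"
    and span_V: "mpoly_vs.span (V k) = J \<inter> mpoly_vs.span (shift_up (N (k - 1)))"
    if "k \<in> {1..s}" for k
    using assms(5) that unfolding is_basis_of_def by auto
  have V_sub: "V k \<subseteq> J \<inter> mpoly_vs.span (shift_up (N (k - 1)))" if "k \<in> {1..s}" for k
    using span_V[OF that] mpoly_vs.span_superset by blast
  have "finite (V k)" if "k \<in> {1..s}" for k
  proof -
    have "finite (shift_up (N (k - 1)))"
      using that by (intro finite_shift_up complement_upto_finite[OF assms(4)]) auto
    then show ?thesis
      using mpoly_vs.independent_span_bound indep[OF that] V_sub[OF that] by blast
  qed
  then have fin: "finite ?V" by blast
  have "V k \<subseteq> graded_part J k" if "k \<in> {1..s}" for k
  proof -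
    have "mpoly_vs.span (shift_up (N (k - 1))) \<subseteq> forms_of_degree (Suc (k - 1))"
      using that by (intro span_shift_up_complement_subset_forms[OF assms(4)]) auto
    then show ?thesis
      using V_sub[OF that] that unfolding graded_part_def by auto
  qed
  then have "ideal_gen ?V \<subseteq> ?I"
    by (intro mpoly_ideal.span_mono) blast
  moreover have "graded_part J k \<subseteq> ideal_gen ?V" if "k \<in> {1..s}" for k
    using that by (intro graded_part_subset_ideal_gen[OF assms(4,3) span_V]) auto
  then have "?I \<subseteq> ideal_gen ?V"
    by (intro mpoly_ideal.span_minimal mpoly_ideal.subspace_span UN_least)
  ultimately have "ideal_gen ?V = ?I" by blast
  with fin obtain G where G: "G \<subseteq> ?V" "minimal_generators G ?I"
    by (rule finite_generators_contain_minimal)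
  from G(1) have "(\<Union>k\<in>{1..s}. G \<inter> V k) = G" by blast
  with G(2) show ?thesis
    by (intro exI[of _ "\<lambda>k. G \<inter> V k"]) simp
qed

end
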